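(* Let $(\mathcal{X},\mathcal{F})$ be a measurable space with filtration $(\mathcal{F}_n)_{n\ge0}$, let $H$ be a collection of probability measures on it, and let $\alpha>0$. Suppose that $(\phi_n)_{n\ge0}$ is a sequential test adapted to $(\mathcal{F}_n)$ that is anytime valid for $H$ at level $\alpha$, and that $\sigma$ is an arbitrary stopping time with respect to $(\mathcal{F}_n)$. (i) Let $\phi^*:\mathcal{X}\to[0,1]$ be an $\mathcal{F}$-measurable test that is valid at conditional significance level $\phi_\sigma$ conditional on $\mathcal{F}_\sigma$: $$\mathbb{E}^{\mathbb{P}}[\phi^*\mid\mathcal{F}_\sigma]\le\phi_\sigma\quad\text{for every }\mathbb{P}\in H.$$ Then $\phi^*$ is valid for $H$ at level $\alpha$. (ii) Suppose that the sequential test $(\phi_n^* )_{n\ge\sigma}$ adapted to $(\mathcal{F}_n)_{n\ge\sigma}$ is conditionally anytime valid at conditional significance level $\phi_\sigma$: for every stopping time $\tau$ with respect to $(\mathcal{F}_n)_{n\ge\sigma}$, $$\mathbb{E}^{\mathbb{P}}[\phi_\tau^*\mid\mathcal{F}_\sigma]\le\phi_\sigma\quad\text{for every }\mathbb{P}\in H.$$ Then the sequential test $(\phi_n^\dagger)$ which equals $\phi_n$ for $n\le\sigma$ and $\phi_n^*$ for $n>\sigma$ (that is, the sequence $\phi_1,\dots,\phi_\sigma,\phi^*_{\sigma+1},\phi^*_{\sigma+2},\dots$) is anytime valid for $H$ at level $\alpha$.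
   Context: $(\mathcal{F}_n)_{n\ge0}$ is a filtration with $\mathcal{F}_n\subseteq\mathcal{F}$, $\mathcal{F}_0=\{\emptyset,\mathcal{X}\}$ and $\mathcal{F}_\infty:=\sigma(\bigcup_n\mathcal{F}_n)$. A test is an $\mathcal{F}$-measurable map into $[0,1]$; it is valid for $H$ at level $\alpha$ if $\sup_{\mathbb{P}\in H}\mathbb{E}^{\mathbb{P}}[\phi]\le\alpha$. A sequential test is an adapted sequence of tests; it is anytime valid for $H$ at level $\alpha$ if $\sup_{\mathbb{P}\in H}\mathbb{E}^{\mathbb{P}}[\phi_\tau]\le\alpha$ for every (possibly infinite) stopping time $\tau$ with respect to $(\mathcal{F}_n)$, where $\phi_\infty:=\limsup_{n\to\infty}\phi_n$. Conditional inequalities hold $\mathbb{P}$-almost surely. A sequential test $(\phi^*_n)_{n\ge\sigma}$ adapted to $(\mathcal{F}_n)_{n\ge\sigma}$ consists of $[0,1]$-valued $\phi_n^*$ defined on $\{\sigma\le n\}$ with $\phi_n^*\mathbb{I}\{\sigma\le n\}$ being $\mathcal{F}_n$-measurable for every $n$; a stopping time with respect to $(\mathcal{F}_n)_{n\ge\sigma}$ is a (possibly infinite) stopping time $\tau$ with respect to $(\mathcal{F}_n)$ with $\tau\ge\sigma$. Here $\phi^*_\infty:=\limsup_{n\to\infty}\phi_n^*$ on $\{\sigma<\infty\}$, and $\phi^*_\infty:=\phi_\infty$ on $\{\sigma=\infty\}$. For a stopping time $\sigma$, $\mathcal{F}_\sigma=\{A\in\mathcal{F}_\infty:A\cap\{\sigma\le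 n\}\in\mathcal{F}_n\ \forall n\ge0\}$. *)

theory Defs
  imports "HOL-Probability.Probability" "HOL-Probability.Stopping_Time"
begin

text \<open>
  A filtration indexed by the naturals is extended to \<^typ>\<open>enat\<close> by putting the generated
  sigma-algebra at infinity. Possibly infinite stopping times are then the library's
  \<^const>\<open>stopping_time\<close> with values in \<^typ>\<open>enat\<close> (the condition at infinity is void), and
  \<^const>\<open>filtration.pre_sigma\<close> yields the usual sigma-algebra of the past of such a stopping
  time (the condition at infinity is membership in the generated sigma-algebra), see
  \<open>sets_past\<close> below.
\<close>

definition filtration_limit :: "'a set \<Rightarrow> (nat \<Rightarrow> 'a measure) \<Rightarrow> 'a measure" where
  "filtration_limit \<Omega> F = sigma \<Omega> (\<Union>n. sets (F n))"

definition ext_filtration :: "'a set \<Rightarrow> (nat \<Rightarrow> 'a measure) \<Rightarrow> enat \<Rightarrow> 'a measure" where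
  "ext_filtration \<Omega> F t = (case t of enat n \<Rightarrow> F n | \<infinity> \<Rightarrow> filtration_limit \<Omega> F)"

definition past :: "'a set \<Rightarrow> (nat \<Rightarrow> 'a measure) \<Rightarrow> ('a \<Rightarrow> enat) \<Rightarrow> 'a measure" where
  "past \<Omega> F \<sigma> = filtration.pre_sigma \<Omega> (ext_filtration \<Omega> F) \<sigma>"

definition is_test :: "'a measure \<Rightarrow> ('a \<Rightarrow> real) \<Rightarrow> bool" where
  "is_test X \<phi> \<longleftrightarrow> \<phi> \<in> borel_measurable X \<and> (\<forall>x\<in>space X. \<phi> x \<in> {0..1})"

text \<open>The supremum is taken in \<^typ>\<open>ereal\<close> so that it is meaningful for empty \<open>H\<close> as well.\<close>

definition valid :: "'a measure set \<Rightarrow> real \<Rightarrow> ('a \<Rightarrow> real) \<Rightarrow> bool" where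
  "valid H \<alpha> \<phi> \<longleftrightarrow> (SUP P\<in>H. ereal (integral\<^sup>L P \<phi>)) \<le> ereal \<alpha>"

definition sequential_test ::
    "'a measure \<Rightarrow> (nat \<Rightarrow> 'a measure) \<Rightarrow> (nat \<Rightarrow> 'a \<Rightarrow> real) \<Rightarrow> bool" where
  "sequential_test X F \<phi> \<longleftrightarrow> (\<forall>n. is_test X (\<phi> n) \<and> \<phi> n \<in> borel_measurable (F n))"

text \<open>For a sequence that is eventually in the unit interval the limes superior is finite, so
  nothing is lost by \<^const>\<open>real_of_ereal\<close>.\<close>

definition limsup_at :: "(nat \<Rightarrow> 'a \<Rightarrow> real) \<Rightarrow> 'a \<Rightarrow> real" where
  "limsup_at \<phi> x = real_of_ereal (limsup (\<lambda>n. ereal (\<phi> n x)))"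

definition stopped :: "(nat \<Rightarrow> 'a \<Rightarrow> real) \<Rightarrow> ('a \<Rightarrow> enat) \<Rightarrow> 'a \<Rightarrow> real" where
  "stopped \<phi> \<tau> x = (case \<tau> x of enat n \<Rightarrow> \<phi> n x | \<infinity> \<Rightarrow> limsup_at \<phi> x)"

definition anytime_valid ::
    "'a measure \<Rightarrow> (nat \<Rightarrow> 'a measure) \<Rightarrow> 'a measure set \<Rightarrow> real \<Rightarrow> (nat \<Rightarrow> 'a \<Rightarrow> real) \<Rightarrow> bool" where
  "anytime_valid X F H \<alpha> \<phi> \<longleftrightarrow>
     (\<forall>\<tau>. stopping_time (ext_filtration (space X) F) \<tau> \<longrightarrow> valid H \<alpha> (stopped \<phi> \<tau>))"

definition conditionally_valid ::
    "'a measure \<Rightarrow> (nat \<Rightarrow> 'a measure) \<Rightarrow> 'a measure set \<Rightarrow> ('a \<Rightarrow> enat) \<Rightarrow>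
     ('a \<Rightarrow> real) \<Rightarrow> ('a \<Rightarrow> real) \<Rightarrow> bool" where
  "conditionally_valid X F H \<sigma> level \<phi> \<longleftrightarrow>
     (\<forall>P\<in>H. AE x in P. real_cond_exp P (past (space X) F \<sigma>) \<phi> x \<le> level x)"

text \<open>
  In a sequential test \<open>\<psi>\<close> that starts at \<open>\<sigma>\<close>, the function \<open>\<psi> n\<close> is only defined on
  \<open>{\<sigma> \<le> n}\<close>. It is represented by a total function whose values outside that set are
  arbitrary and never used.
\<close>

definition sequential_test_from ::
    "'a measure \<Rightarrow> (nat \<Rightarrow> 'a measure) \<Rightarrow> ('a \<Rightarrow> enat) \<Rightarrow> (nat \<Rightarrow> 'a \<Rightarrow> real) \<Rightarrow> bool" where
  "sequential_test_from X F \<sigma> \<psi> \<longleftrightarrow>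
     (\<forall>n. (\<forall>x\<in>space X. \<sigma> x \<le> enat n \<longrightarrow> \<psi> n x \<in> {0..1}) \<and>
          (\<lambda>x. \<psi> n x * indicator {x. \<sigma> x \<le> enat n} x) \<in> borel_measurable (F n))"

definition stopping_time_from ::
    "'a measure \<Rightarrow> (nat \<Rightarrow> 'a measure) \<Rightarrow> ('a \<Rightarrow> enat) \<Rightarrow> ('a \<Rightarrow> enat) \<Rightarrow> bool" where
  "stopping_time_from X F \<sigma> \<tau> \<longleftrightarrow>
     stopping_time (ext_filtration (space X) F) \<tau> \<and> (\<forall>x\<in>space X. \<sigma> x \<le> \<tau> x)"

text \<open>The value at \<open>\<tau> \<ge> \<sigma>\<close> of a sequential test \<open>\<psi>\<close> that starts at \<open>\<sigma>\<close> and continues \<open>\<phi>\<close>: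
  where \<open>\<sigma>\<close> is infinite, \<open>\<psi>\<close> never starts and its value at infinity is that of \<open>\<phi>\<close>.\<close>

definition stopped_from ::
    "(nat \<Rightarrow> 'a \<Rightarrow> real) \<Rightarrow> ('a \<Rightarrow> enat) \<Rightarrow> (nat \<Rightarrow> 'a \<Rightarrow> real) \<Rightarrow> ('a \<Rightarrow> enat) \<Rightarrow> 'a \<Rightarrow> real" where
  "stopped_from \<phi> \<sigma> \<psi> \<tau> x =
     (case \<tau> x of
        enat n \<Rightarrow> \<psi> n x
      | \<infinity> \<Rightarrow> (if \<sigma> x = \<infinity> then limsup_at \<phi> x else limsup_at \<psi> x))"

definition conditionally_anytime_valid ::
    "'a measure \<Rightarrow> (nat \<Rightarrow> 'a measure) \<Rightarrow> 'a measure set \<Rightarrow> ('a \<Rightarrow> enat) \<Rightarrow>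
     (nat \<Rightarrow> 'a \<Rightarrow> real) \<Rightarrow> (nat \<Rightarrow> 'a \<Rightarrow> real) \<Rightarrow> bool" where
  "conditionally_anytime_valid X F H \<sigma> \<phi> \<psi> \<longleftrightarrow>
     (\<forall>\<tau>. stopping_time_from X F \<sigma> \<tau> \<longrightarrow>
        conditionally_valid X F H \<sigma> (stopped \<phi> \<sigma>) (stopped_from \<phi> \<sigma> \<psi> \<tau>))"

definition switch_test ::
    "(nat \<Rightarrow> 'a \<Rightarrow> real) \<Rightarrow> ('a \<Rightarrow> enat) \<Rightarrow> (nat \<Rightarrow> 'a \<Rightarrow> real) \<Rightarrow> nat \<Rightarrow> 'a \<Rightarrow> real" where
  "switch_test \<phi> \<sigma> \<psi> n x = (if enat n \<le> \<sigma> x then \<phi> n x else \<psi> n x)"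

lemma filtration_ext_filtration:
  assumes "filtration \<Omega> F"
  shows "filtration \<Omega> (ext_filtration \<Omega> F)"
proof -
  interpret filtration \<Omega> F by fact
  have sub: "(\<Union>n. sets (F n)) \<subseteq> Pow \<Omega>"
  proof (intro UN_least subsetI PowI)
    fix n A x assume "A \<in> sets (F n)" "x \<in> A"
    then show "x \<in> \<Omega>"
      using sets.sets_into_space[of A "F n"] space_F[of n] by auto
  qed
  show ?thesis
  proof
    show "space (ext_filtration \<Omega> F i) = \<Omega>" for i
      using sub by (auto simp: ext_filtration_def filtration_limit_def space_F space_measure_of
        split: enat.split)
    show "sets (ext_filtration \<Omega> F i) \<le> sets (ext_filtration \<Omega> F j)" if "i \<le> j" for i j
    proof (cases j)
      case (enat m)
      with that show ?thesis
        using sets_F_mono by (cases i) (auto simp: ext_filtration_def)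
    next
      case infinity
      then show ?thesis
        using sub by (cases i) (auto simp: ext_filtration_def filtration_limit_def)
    qed
  qed
qed

lemma stopping_time_ext_filtration_iff:
  assumes "filtration \<Omega> F"
  shows "stopping_time (ext_filtration \<Omega> F) \<tau> \<longleftrightarrow> (\<forall>n. {x\<in>\<Omega>. \<tau> x \<le> enat n} \<in> sets (F n))"
proof -
  interpret E: filtration \<Omega> "ext_filtration \<Omega> F"
    using assms by (rule filtration_ext_filtration)
  have top: "\<Omega> \<in> sets (ext_filtration \<Omega> F \<infinity>)"
    using sets.top[of "ext_filtration \<Omega> F \<infinity>"] by (simp add: E.space_F)
  have "stopping_time (ext_filtration \<Omega> F) \<tau> \<longleftrightarrow>
      (\<forall>t. {x\<in>\<Omega>. \<tau> x \<le> t} \<in> sets (ext_filtration \<Omega> F t))"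
    by (simp add: stopping_time_def pred_def E.space_F)
  also have "\<dots> \<longleftrightarrow> (\<forall>n. {x\<in>\<Omega>. \<tau> x \<le> enat n} \<in> sets (ext_filtration \<Omega> F (enat n)))"
  proof (intro iffI allI)
    fix t assume *: "\<forall>n. {x\<in>\<Omega>. \<tau> x \<le> enat n} \<in> sets (ext_filtration \<Omega> F (enat n))"
    show "{x\<in>\<Omega>. \<tau> x \<le> t} \<in> sets (ext_filtration \<Omega> F t)"
      using * top by (cases t) auto
  qed auto
  finally show ?thesis
    by (simp add: ext_filtration_def)
qed

lemma sets_past:
  assumes "filtration \<Omega> F" "stopping_time (ext_filtration \<Omega> F) \<sigma>"
  shows "sets (past \<Omega> F \<sigma>) =
    {A \<in> sets (filtration_limit \<Omega> F). \<forall>n. A \<inter> {x\<in>\<Omega>. \<sigma> x \<le> enat n} \<in> sets (F n)}"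
    (is "_ = ?R")
proof -
  interpret E: filtration \<Omega> "ext_filtration \<Omega> F"
    using assms(1) by (rule filtration_ext_filtration)
  have lim: "ext_filtration \<Omega> F \<infinity> = filtration_limit \<Omega> F"
    and fin: "\<And>n. ext_filtration \<Omega> F (enat n) = F n"
    by (simp_all add: ext_filtration_def)
  have restr: "A \<inter> {x\<in>\<Omega>. \<sigma> x \<le> t} = {x\<in>A. \<sigma> x \<le> t}"
    if "A \<in> sets (filtration_limit \<Omega> F)" for A t
    using sets.sets_into_space[OF that] E.space_F[of \<infinity>] by (auto simp: lim)
  have "sets (past \<Omega> F \<sigma>) = {A. \<forall>t. {x\<in>A. \<sigma> x \<le> t} \<in> sets (ext_filtration \<Omega> F t)}"
    unfolding past_def by (rule E.sets_pre_sigma[OF assms(2)])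
  also have "\<dots> = {A \<in> sets (filtration_limit \<Omega> F). \<forall>n. {x\<in>A. \<sigma> x \<le> enat n} \<in> sets (F n)}"
  proof (intro Collect_cong iffI conjI allI)
    fix A assume *: "\<forall>t. {x\<in>A. \<sigma> x \<le> t} \<in> sets (ext_filtration \<Omega> F t)"
    show "A \<in> sets (filtration_limit \<Omega> F)"
      using *[rule_format, of \<infinity>] by (simp add: lim)
    show "{x\<in>A. \<sigma> x \<le> enat n} \<in> sets (F n)" for n
      using *[rule_format, of "enat n"] by (simp add: fin)
  next
    fix A t
    assume "A \<in> sets (filtration_limit \<Omega> F) \<and> (\<forall>n. {x\<in>A. \<sigma> x \<le> enat n} \<in> sets (F n))"
    then show "{x\<in>A. \<sigma> x \<le> t} \<in> sets (ext_filtration \<Omega> F t)"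
      by (cases t) (auto simp: lim fin)
  qed
  also have "\<dots> = ?R"
    using restr by auto
  finally show ?thesis .
qed

end

theory Submission
  imports Defs
begin

text \<open>
  Both parts rest on one fact about conditional expectations. If \<open>B\<close> belongs to a
  sub-sigma-algebra \<open>G\<close> and the conditional expectation of \<open>g\<close> given \<open>G\<close> is at most \<open>h\<close> on \<open>B\<close>,
  then replacing \<open>h\<close> by \<open>g\<close> on \<open>B\<close> does not increase the expectation
  (\<open>integral_replace_le\<close>). Here \<open>G\<close> is the past of \<open>\<sigma>\<close>, and \<open>h\<close> is \<open>\<phi>\<close> stopped at a suitable
  time, so that the expectation of \<open>h\<close> is at most \<open>\<alpha>\<close> by anytime validity of \<open>\<phi>\<close>.

  For part (i), take \<open>B\<close> to be the whole space and \<open>h\<close> to be \<open>\<phi>\<close> stopped at \<open>\<sigma>\<close>.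

  For part (ii), let \<open>\<tau>\<close> be a stopping time for the switched test. On \<open>B = {\<sigma> < \<tau>}\<close> the
  switched test has moved on to \<open>\<psi>\<close>, and its value at \<open>\<tau>\<close> is that of \<open>\<psi>\<close> at \<open>max \<tau> \<sigma>\<close>, a
  stopping time to which the conditional hypothesis applies; off \<open>B\<close> the value is that of
  \<open>\<phi>\<close> at \<open>\<tau>\<close>. Take \<open>h\<close> to be \<open>\<phi>\<close> stopped at \<open>min \<tau> \<sigma>\<close>: it agrees with the switched test off
  \<open>B\<close> and with \<open>\<phi>\<close> at \<open>\<sigma>\<close>, the conditional level, on \<open>B\<close>. As \<open>B\<close> lies in the past of \<open>\<sigma>\<close>, the
  replacement of \<open>h\<close> by \<open>\<psi>\<close> at \<open>max \<tau> \<sigma>\<close> on \<open>B\<close> is allowed.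
\<close>

section \<open>Replacing a random variable on an event of the past\<close>

lemma valid_iff: "valid H \<alpha> \<phi> \<longleftrightarrow> (\<forall>P\<in>H. integral\<^sup>L P \<phi> \<le> \<alpha>)"
  by (simp add: valid_def SUP_le_iff)

text \<open>Since \<open>B\<close> is in \<open>G\<close>, the integrals over \<open>B\<close> of \<open>g\<close> and of its conditional expectation
  coincide.\<close>

lemma (in sigma_finite_subalgebra) integral_replace_le:
  assumes B: "B \<in> sets F"
    and g: "integrable M g" and h: "integrable M h"
    and le: "AE x in M. x \<in> B \<longrightarrow> real_cond_exp M F g x \<le> h x"
  shows "(\<integral>x. (if x \<in> B then g x else h x) \<partial>M) \<le> (\<integral>x. h x \<partial>M)"
proof -
  have BM: "B \<in> sets M"
    using B subalg by (auto simp: subalgebra_def)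
  have int: "set_integrable M A f" if "integrable M f" "A \<in> sets M" for A and f :: "'a \<Rightarrow> real"
    using that unfolding set_integrable_def by (intro integrable_mult_indicator)
  have CM: "space M - B \<in> sets M"
    using BM by simp
  have split: "(\<integral>x. (if x \<in> B then f x else h x) \<partial>M)
      = (\<integral>x\<in>B. f x \<partial>M) + (\<integral>x\<in>space M - B. h x \<partial>M)" if "integrable M f" for f
  proof -
    have "(\<integral>x. (if x \<in> B then f x else h x) \<partial>M)
        = (\<integral>x. indicator B x *\<^sub>R f x + indicator (space M - B) x *\<^sub>R h x \<partial>M)"
      by (intro Bochner_Integration.integral_cong) auto
    also have "\<dots> = (\<integral>x\<in>B. f x \<partial>M) + (\<integral>x\<in>space M - B. h x \<partial>M)"
      unfolding set_lebesgue_integral_def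
      using int[OF that BM] int[OF h CM] unfolding set_integrable_def
      by (intro Bochner_Integration.integral_add)
    finally show ?thesis .
  qed
  have "(\<integral>x\<in>B. g x \<partial>M) = (\<integral>x\<in>B. real_cond_exp M F g x \<partial>M)"
    using g B by (rule real_cond_exp_intA)
  also have "\<dots> \<le> (\<integral>x\<in>B. h x \<partial>M)"
    using le by (intro set_integral_mono_AE int real_cond_exp_int(1) g h BM) auto
  finally show ?thesis
    using split[OF g] split[OF h] by simp
qed

section \<open>Tests stopped at random times\<close>

lemma limsup_at_cong:
  assumes "eventually (\<lambda>n. \<phi> n x = \<psi> n x) sequentially"
  shows "limsup_at \<phi> x = limsup_at \<psi> x"
proof -
  have "limsup (\<lambda>n. ereal (\<phi> n x)) = limsup (\<lambda>n. ereal (\<psi> n x))"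
    using assms by (intro Limsup_eq) (auto elim: eventually_mono)
  then show ?thesis
    by (simp add: limsup_at_def)
qed

lemma is_test_limsup_at:
  assumes "\<And>n. is_test X (\<phi> n)"
  shows "is_test X (limsup_at \<phi>)"
  unfolding is_test_def
proof (intro conjI ballI)
  have [measurable]: "\<phi> n \<in> borel_measurable X" for n
    using assms by (simp add: is_test_def)
  show "limsup_at \<phi> \<in> borel_measurable X"
    unfolding limsup_at_def[abs_def] by measurable
next
  fix x assume "x \<in> space X"
  then have bounds: "0 \<le> \<phi> n x" "\<phi> n x \<le> 1" for n
    using assms[of n] by (auto simp: is_test_def)
  have "0 \<le> limsup (\<lambda>n. ereal (\<phi> n x))"
    using bounds by (intro le_Limsup) auto
  moreover have "limsup (\<lambda>n. ereal (\<phi> n x)) \<le> 1"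
    using bounds by (intro Limsup_bounded) auto
  ultimately show "limsup_at \<phi> x \<in> {0..1}"
    unfolding limsup_at_def by (cases "limsup (\<lambda>n. ereal (\<phi> n x))") auto
qed

text \<open>The values of a stopping time are countable, so measurability of a stopped sequence can be
  checked at each fixed time, infinity included.\<close>

lemma is_test_stopped:
  assumes F: "filtration (space X) F" "\<And>n. subalgebra X (F n)"
    and \<phi>: "\<And>n. is_test X (\<phi> n)"
    and \<tau>: "stopping_time (ext_filtration (space X) F) \<tau>"
  shows "is_test X (stopped \<phi> \<tau>)"
  unfolding is_test_def
proof (intro conjI ballI)
  have le: "{x \<in> space X. \<tau> x \<le> enat n} \<in> sets X" for n
    using \<tau> F(2)[of n] unfolding stopping_time_ext_filtration_iff[OF F(1)]
    by (auto simp: subalgebra_def)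
  have [measurable]: "\<tau> \<in> X \<rightarrow>\<^sub>M count_space UNIV"
    unfolding measurable_count_space_eq2_countable
  proof (intro conjI ballI)
    fix t :: enat
    show "\<tau> -` {t} \<inter> space X \<in> sets X"
    proof (cases t)
      case (enat n)
      have "\<tau> -` {t} \<inter> space X
          = {x \<in> space X. \<tau> x \<le> enat n} - (\<Union>m\<in>{..<n}. {x \<in> space X. \<tau> x \<le> enat m})"
      proof (intro set_eqI)
        fix x
        show "x \<in> \<tau> -` {t} \<inter> space X \<longleftrightarrow>
            x \<in> {x \<in> space X. \<tau> x \<le> enat n} - (\<Union>m\<in>{..<n}. {x \<in> space X. \<tau> x \<le> enat m})"
          using enat by (cases "\<tau> x") auto
      qed
      then show ?thesis
        using le by auto
    next
      case infinity
      have "\<tau> -` {t} \<inter> space X = space X - (\<Union>m. {x \<in> space X. \<tau> x \<le> enat m})"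
      proof (intro set_eqI)
        fix x
        show "x \<in> \<tau> -` {t} \<inter> space X \<longleftrightarrow> x \<in> space X - (\<Union>m. {x \<in> space X. \<tau> x \<le> enat m})"
          using infinity by (cases "\<tau> x") auto
      qed
      then show ?thesis
        using le by auto
    qed
  qed auto
  have [measurable]: "\<phi> n \<in> borel_measurable X" "limsup_at \<phi> \<in> borel_measurable X" for n
    using \<phi> is_test_limsup_at[of X \<phi>, OF \<phi>] by (auto simp: is_test_def)
  show "stopped \<phi> \<tau> \<in> borel_measurable X"
    unfolding stopped_def[abs_def] by measurable
next
  fix x assume "x \<in> space X"
  then show "stopped \<phi> \<tau> x \<in> {0..1}"
    using \<phi> is_test_limsup_at[of X \<phi>, OF \<phi>]
    by (cases "\<tau> x") (auto simp: stopped_def is_test_def)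
qed

lemma integrable_test:
  assumes "prob_space P" "sets P = sets X" "is_test X f"
  shows "integrable P f"
proof -
  interpret prob_space P by fact
  have "space P = space X"
    using assms(2) by (rule sets_eq_imp_space_eq)
  moreover have "f \<in> borel_measurable P"
    using assms(3) unfolding measurable_cong_sets[OF assms(2) refl] by (simp add: is_test_def)
  ultimately show ?thesis
    using assms(3) by (intro integrable_const_bound[where B = 1] AE_I2) (auto simp: is_test_def)
qed

lemma subalgebra_past:
  assumes F: "filtration (space X) F" "\<And>n. subalgebra X (F n)"
    and \<sigma>: "stopping_time (ext_filtration (space X) F) \<sigma>"
  shows "subalgebra X (past (space X) F \<sigma>)"
proof -
  have "(\<Union>n. sets (F n)) \<subseteq> sets X"
    using F(2) by (auto simp: subalgebra_def)
  then have "sigma_sets (space X) (\<Union>n. sets (F n)) \<subseteq> sets X"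
    by (rule sets.sigma_sets_subset)
  moreover have "(\<Union>n. sets (F n)) \<subseteq> Pow (space X)"
    using \<open>(\<Union>n. sets (F n)) \<subseteq> sets X\<close> sets.space_closed by blast
  ultimately have "sets (filtration_limit (space X) F) \<subseteq> sets X"
    by (simp add: filtration_limit_def)
  then have "sets (past (space X) F \<sigma>) \<subseteq> sets X"
    unfolding sets_past[OF F(1) \<sigma>] by blast
  moreover have "space (past (space X) F \<sigma>) = space X"
    unfolding past_def by (rule filtration.space_pre_sigma[OF filtration_ext_filtration[OF F(1)]])
  ultimately show ?thesis
    by (simp add: subalgebra_def)
qed

section \<open>Tests that start at a stopping time\<close>

text \<open>A test that starts at \<open>\<sigma>\<close> is measurable at time \<open>n\<close> only on \<open>{\<sigma> \<le> n}\<close>, so it can be spliced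
  into \<open>\<phi>\<close> on any event \<open>C n\<close> known at time \<open>n\<close> that implies \<open>\<sigma> \<le> n\<close>. The switched test has \<open>C n = {\<sigma> < n}\<close>. The choice
  \<open>C n = {\<sigma> \<le> n}\<close> keeps every defined value of \<open>\<psi>\<close>, and reduces questions about \<open>\<psi>\<close> stopped
  after \<open>\<sigma>\<close> to questions about an ordinary sequential test.\<close>

lemma sequential_test_merge:
  assumes F: "\<And>n. subalgebra X (F n)"
    and \<phi>: "sequential_test X F \<phi>" and \<psi>: "sequential_test_from X F \<sigma> \<psi>"
    and C: "\<And>n. Measurable.pred (F n) (C n)"
    and C_le: "\<And>n x. C n x \<Longrightarrow> \<sigma> x \<le> enat n"
  shows "sequential_test X F (\<lambda>n x. if C n x then \<psi> n x else \<phi> n x)"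
  unfolding sequential_test_def is_test_def
proof (intro allI conjI ballI)
  fix n
  note C[of n, measurable]
  have [measurable]: "\<phi> n \<in> borel_measurable (F n)"
      "(\<lambda>x. \<psi> n x * indicator {x. \<sigma> x \<le> enat n} x) \<in> borel_measurable (F n)"
    using \<phi> \<psi> by (auto simp: sequential_test_def sequential_test_from_def)
  have "(\<lambda>x. if C n x then \<psi> n x * indicator {x. \<sigma> x \<le> enat n} x else \<phi> n x)
      \<in> borel_measurable (F n)"
    by measurable
  also have "(\<lambda>x. if C n x then \<psi> n x * indicator {x. \<sigma> x \<le> enat n} x else \<phi> n x)
      = (\<lambda>x. if C n x then \<psi> n x else \<phi> n x)"
    using C_le by auto
  finally show meas: "(\<lambda>x. if C n x then \<psi> n x else \<phi> n x) \<in> borel_measurable (F n)" .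
  then show "(\<lambda>x. if C n x then \<psi> n x else \<phi> n x) \<in> borel_measurable X"
    by (rule measurable_from_subalg[OF F])
  fix x assume "x \<in> space X"
  then show "(if C n x then \<psi> n x else \<phi> n x) \<in> {0..1}"
    using \<phi> \<psi> C_le[of n x]
    by (auto simp: sequential_test_def is_test_def sequential_test_from_def)
qed

lemma sequential_test_switch:
  assumes F: "filtration (space X) F" "\<And>n. subalgebra X (F n)"
    and \<sigma>: "stopping_time (ext_filtration (space X) F) \<sigma>"
    and \<phi>: "sequential_test X F \<phi>" and \<psi>: "sequential_test_from X F \<sigma> \<psi>"
  shows "sequential_test X F (switch_test \<phi> \<sigma> \<psi>)"
proof -
  interpret E: filtration "space X" "ext_filtration (space X) F"
    using F(1) by (rule filtration_ext_filtration)
  have "Measurable.pred (F n) (\<lambda>x. \<sigma> x < enat n)" for n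
    using E.stopping_time_less_const[OF \<sigma>, of "enat n"] by (simp add: ext_filtration_def)
  then have "sequential_test X F (\<lambda>n x. if \<sigma> x < enat n then \<psi> n x else \<phi> n x)"
    by (intro sequential_test_merge[OF F(2) \<phi> \<psi>]) auto
  also have "(\<lambda>n x. if \<sigma> x < enat n then \<psi> n x else \<phi> n x) = switch_test \<phi> \<sigma> \<psi>"
    by (auto simp: switch_test_def fun_eq_iff)
  finally show ?thesis .
qed

text \<open>From a finite \<open>\<sigma>\<close> on, the completed test is \<open>\<psi>\<close>; where \<open>\<sigma>\<close> is infinite it is \<open>\<phi>\<close>
  throughout. These are the two cases in the value of \<open>\<psi>\<close> at infinity.\<close>

lemma is_test_stopped_from:
  assumes F: "filtration (space X) F" "\<And>n. subalgebra X (F n)"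
    and \<sigma>: "stopping_time (ext_filtration (space X) F) \<sigma>"
    and \<phi>: "sequential_test X F \<phi>" and \<psi>: "sequential_test_from X F \<sigma> \<psi>"
    and \<tau>: "stopping_time_from X F \<sigma> \<tau>"
  shows "is_test X (stopped_from \<phi> \<sigma> \<psi> \<tau>)"
proof -
  define \<xi> where "\<xi> = (\<lambda>n x. if \<sigma> x \<le> enat n then \<psi> n x else \<phi> n x)"
  have "Measurable.pred (F n) (\<lambda>x. \<sigma> x \<le> enat n)" for n
    using stopping_timeD[OF \<sigma>, of "enat n"] by (simp add: ext_filtration_def)
  then have "sequential_test X F \<xi>"
    unfolding \<xi>_def by (intro sequential_test_merge[OF F(2) \<phi> \<psi>]) auto
  then have "is_test X (stopped \<xi> \<tau>)"
    using \<tau> by (intro is_test_stopped[OF F])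
      (auto simp: sequential_test_def stopping_time_from_def)
  moreover have "stopped \<xi> \<tau> x = stopped_from \<phi> \<sigma> \<psi> \<tau> x" if "x \<in> space X" for x
  proof -
    have le: "\<sigma> x \<le> \<tau> x"
      using \<tau> that by (simp add: stopping_time_from_def)
    have "limsup_at \<xi> x = (if \<sigma> x = \<infinity> then limsup_at \<phi> x else limsup_at \<psi> x)"
    proof (cases "\<sigma> x")
      case (enat m)
      then have "limsup_at \<xi> x = limsup_at \<psi> x"
        by (intro limsup_at_cong eventually_sequentiallyI[of m]) (auto simp: \<xi>_def)
      with enat show ?thesis by simp
    next
      case infinity
      then have "limsup_at \<xi> x = limsup_at \<phi> x"
        by (intro limsup_at_cong) (auto simp: \<xi>_def)
      with infinity show ?thesis by simp
    qed
    then show ?thesis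
      using le by (cases "\<tau> x") (auto simp: stopped_def stopped_from_def \<xi>_def)
  qed
  ultimately show ?thesis
    by (simp add: is_test_def cong: measurable_cong)
qed

text \<open>Off \<open>{\<sigma> < \<tau>}\<close> the switched test still follows \<open>\<phi>\<close> at time \<open>\<tau>\<close>. This includes \<open>\<tau> = \<sigma> = \<infinity>\<close>,
  where the switch never happens; for \<open>\<sigma> < \<tau> = \<infinity>\<close> the limes superior sees only \<open>\<psi>\<close>.\<close>

lemma stopped_switch_test:
  "stopped (switch_test \<phi> \<sigma> \<psi>) \<tau> x =
    (if \<sigma> x < \<tau> x then stopped_from \<phi> \<sigma> \<psi> (\<lambda>x. max (\<tau> x) (\<sigma> x)) x
     else stopped \<phi> (\<lambda>x. min (\<tau> x) (\<sigma> x)) x)"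
proof (cases "\<tau> x")
  case (enat n)
  then show ?thesis
    by (auto simp: stopped_def stopped_from_def switch_test_def max_def min_def not_less)
next
  case tau: infinity
  show ?thesis
  proof (cases "\<sigma> x")
    case (enat m)
    then have "limsup_at (switch_test \<phi> \<sigma> \<psi>) x = limsup_at \<psi> x"
      by (intro limsup_at_cong eventually_sequentiallyI[of "Suc m"]) (auto simp: switch_test_def)
    with tau enat show ?thesis
      by (auto simp: stopped_def stopped_from_def)
  next
    case infinity
    then have "limsup_at (switch_test \<phi> \<sigma> \<psi>) x = limsup_at \<phi> x"
      by (intro limsup_at_cong) (auto simp: switch_test_def)
    with tau infinity show ?thesis
      by (auto simp: stopped_def)
  qed
qed

section \<open>Optional continuation of an anytime valid test\<close>

theorem theorem5:
  fixes X :: "'a measure"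
    and F :: "nat \<Rightarrow> 'a measure"
    and H :: "'a measure set"
    and \<alpha> :: real
    and \<phi> :: "nat \<Rightarrow> 'a \<Rightarrow> real"
    and \<sigma> :: "'a \<Rightarrow> enat"
  assumes "filtration (space X) F"
    and "\<And>n. subalgebra X (F n)"
    and "sets (F 0) = {{}, space X}"
    and "\<And>P. P \<in> H \<Longrightarrow> prob_space P \<and> sets P = sets X"
    and "\<alpha> > 0"
    and "sequential_test X F \<phi>"
    and "anytime_valid X F H \<alpha> \<phi>"
    and "stopping_time (ext_filtration (space X) F) \<sigma>"
  shows "(\<forall>\<psi>. is_test X \<psi> \<and> conditionally_valid X F H \<sigma> (stopped \<phi> \<sigma>) \<psi> \<longrightarrow> valid H \<alpha> \<psi>) \<and>
    (\<forall>\<psi>. sequential_test_from X F \<sigma> \<psi> \<and> conditionally_anytime_valid X F H \<sigma> \<phi> \<psi> \<longrightarrow>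
       sequential_test X F (switch_test \<phi> \<sigma> \<psi>) \<and>
       anytime_valid X F H \<alpha> (switch_test \<phi> \<sigma> \<psi>))"
proof (intro conjI allI impI)
  note F = assms(1,2) and H = assms(4) and \<phi> = assms(6) and \<sigma> = assms(8)
  let ?E = "ext_filtration (space X) F" and ?G = "past (space X) F \<sigma>"
  interpret E: filtration "space X" ?E
    using F(1) by (rule filtration_ext_filtration)
  have le_\<alpha>: "integral\<^sup>L P (stopped \<phi> \<tau>) \<le> \<alpha>" if "P \<in> H" "stopping_time ?E \<tau>" for P \<tau>
    using assms(7) that by (auto simp: anytime_valid_def valid_iff)
  have test_\<phi>: "is_test X (stopped \<phi> \<tau>)" if "stopping_time ?E \<tau>" for \<tau>
    using \<phi> that by (intro is_test_stopped[OF F]) (auto simp: sequential_test_def)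
  have spaces: "space P = space X" if "P \<in> H" for P
    using H[OF that] by (intro sets_eq_imp_space_eq) simp
  have subalg: "sigma_finite_subalgebra P ?G" if "P \<in> H" for P
  proof -
    interpret prob_space P
      using H[OF that] by simp
    have "subalgebra P ?G"
      using subalgebra_past[OF F \<sigma>] H[OF that] spaces[OF that] by (simp add: subalgebra_def)
    then show ?thesis
      by (intro finite_measure_subalgebra_is_sigma_finite finite_measure_subalgebra.intro
          finite_measure_subalgebra_axioms.intro finite_measure_axioms)
  qed
  {
    fix \<psi> assume \<psi>: "is_test X \<psi> \<and> conditionally_valid X F H \<sigma> (stopped \<phi> \<sigma>) \<psi>"
    show "valid H \<alpha> \<psi>"
      unfolding valid_iff
    proof
      fix P assume P: "P \<in> H"
      interpret sigma_finite_subalgebra P ?G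
        using P by (rule subalg)
      have "space X \<in> sets ?G"
        using sets.top[of ?G] subalgebra_past[OF F \<sigma>] by (metis subalgebra_def)
      then have "(\<integral>x. (if x \<in> space X then \<psi> x else stopped \<phi> \<sigma> x) \<partial>P)
          \<le> integral\<^sup>L P (stopped \<phi> \<sigma>)"
        using \<psi> P H[OF P] test_\<phi>[OF \<sigma>]
        by (intro integral_replace_le) (auto intro: integrable_test simp: conditionally_valid_def)
      also have "(\<integral>x. (if x \<in> space X then \<psi> x else stopped \<phi> \<sigma> x) \<partial>P) = integral\<^sup>L P \<psi>"
        by (intro Bochner_Integration.integral_cong) (auto simp: spaces[OF P])
      also note le_\<alpha>[OF P \<sigma>]
      finally show "integral\<^sup>L P \<psi> \<le> \<alpha>" by simp
    qed
  next
    fix \<psi>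
    assume \<psi>: "sequential_test_from X F \<sigma> \<psi> \<and> conditionally_anytime_valid X F H \<sigma> \<phi> \<psi>"
    then show "sequential_test X F (switch_test \<phi> \<sigma> \<psi>)"
      using sequential_test_switch[OF F \<sigma> \<phi>] by blast
    show "anytime_valid X F H \<alpha> (switch_test \<phi> \<sigma> \<psi>)"
      unfolding anytime_valid_def valid_iff
    proof (intro allI impI ballI)
      fix \<tau> P assume \<tau>: "stopping_time ?E \<tau>" and P: "P \<in> H"
      interpret sigma_finite_subalgebra P ?G
        using P by (rule subalg)
      define B where "B = {x \<in> space X. \<sigma> x < \<tau> x}"
      let ?max = "\<lambda>x. max (\<tau> x) (\<sigma> x)" and ?min = "\<lambda>x. min (\<tau> x) (\<sigma> x)"
      let ?g = "stopped_from \<phi> \<sigma> \<psi> ?max" and ?h = "stopped \<phi> ?min"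
      have max: "stopping_time_from X F \<sigma> ?max"
        using \<tau> \<sigma> by (auto simp: stopping_time_from_def intro: stopping_time_max)
      have min: "stopping_time ?E ?min"
        using \<tau> \<sigma> by (rule stopping_time_min)
      have "AE x in P. real_cond_exp P ?G ?g x \<le> stopped \<phi> \<sigma> x"
        using \<psi> max P by (auto simp: conditionally_anytime_valid_def conditionally_valid_def)
      \<comment> \<open>On \<open>B\<close> the minimum of \<open>\<tau>\<close> and \<open>\<sigma>\<close> is \<open>\<sigma>\<close>, so \<open>?h\<close> is there the conditional level.\<close>
      then have le: "AE x in P. x \<in> B \<longrightarrow> real_cond_exp P ?G ?g x \<le> ?h x"
        by eventually_elim (auto simp: B_def stopped_def min_def not_le)
      have B: "B \<in> sets ?G"
        using E.stopping_time_less[OF \<sigma> \<tau>]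
        by (simp add: B_def past_def pred_def E.space_pre_sigma)
      have "integral\<^sup>L P (stopped (switch_test \<phi> \<sigma> \<psi>) \<tau>) = (\<integral>x. (if x \<in> B then ?g x else ?h x) \<partial>P)"
        by (intro Bochner_Integration.integral_cong)
          (auto simp: B_def spaces[OF P] stopped_switch_test)
      also have "\<dots> \<le> integral\<^sup>L P ?h"
        using H[OF P] is_test_stopped_from[OF F \<sigma> \<phi> _ max] \<psi> test_\<phi>[OF min]
        by (intro integral_replace_le B le) (auto intro: integrable_test)
      also have "\<dots> \<le> \<alpha>"
        using P min by (rule le_\<alpha>)
      finally show "integral\<^sup>L P (stopped (switch_test \<phi> \<sigma> \<psi>) \<tau>) \<le> \<alpha>" .
    qed
  }
qed

end
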